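(* Let $\theta=(\theta_1,\theta_2)\in(0,\pi/2)\times(0,\pi/2)$ be such that the matrix $S_\theta$ is invertible, let $\mathbf{u}_\theta$ be the SVO-Nash equilibrium, and let $(\phi,t)=\Theta_\phi^{-1}(\theta_1,\theta_2)$, i.e. $(\phi,t)\in(0,\pi/2)\times(0,\infty)$ with $\tan\theta_1=t\cos\phi$ and $\tan\theta_2=t\sin\phi$. Let $H_\phi=\mathrm{blkdiag}(\cos\phi\, I_{d_1},\ \sin\phi\, I_{d_2})$ and suppose $\mathbf{M}H_\phi^{-1}\mathbf{N}^{-1}$ is diagonalizable (over $\mathbb{C}$) with eigenvalues $\lambda_{\phi 1},\dots,\lambda_{\phi d}$, a basis of right eigenvectors $V_{\phi 1},\dots,V_{\phi d}$, and corresponding left eigenvectors $W_{\phi 1}^\top,\dots,W_{\phi d}^\top$ normalized so that $W_{\phi i}^\top V_{\phi j}=\delta_{ij}$. Then $$\mathbf{u}_\theta=\mathbf{u}_{\mathrm N}+G_\phi(t)\,\big[\mathbf{u}_{\mathrm A}-\mathbf{u}_{\mathrm N}\big],$$ where $$G_\phi(t)=\Big[\tfrac1t\,\mathbf{M}H_\phi^{-1}\mathbf{N}^{-1}+I\Big]^{-\top}=\sum_{i=1}^d W_{\phi i}\,\frac{t}{\lambda_{\phi i}+t}\,V_{\phi i}^\top .$$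
   Context: Two-player quadratic game: $d_1,d_2\ge 1$, $d=d_1+d_2$, joint action $u=(u_1,u_2)\in\mathbb{R}^{d_1}\times\mathbb{R}^{d_2}$. Costs $J_i(u)=\tfrac12u^\top M_iu+c_i^\top u$, $i=1,2$, with symmetric real matrices $$M_1=\begin{bmatrix} A_1 & B_1^\top \\ B_1 & D_1 \end{bmatrix},\quad M_2=\begin{bmatrix} D_2 & B_2 \\ B_2^\top & A_2 \end{bmatrix},\quad c_1=\begin{bmatrix} a_1 \\ b_1 \end{bmatrix},\quad c_2=\begin{bmatrix} b_2 \\ a_2 \end{bmatrix},$$ where $A_1,D_2\in\mathbb{R}^{d_1\times d_1}$, $A_2,D_1\in\mathbb{R}^{d_2\times d_2}$, $B_1\in\mathbb{R}^{d_2\times d_1}$, $B_2\in\mathbb{R}^{d_1\times d_2}$, $a_1,b_2\in\mathbb{R}^{d_1}$, $a_2,b_1\in\mathbb{R}^{d_2}$. Put $$\mathbf{M}=\begin{bmatrix} A_1 & B_2 \\ B_1 & A_2 \end{bmatrix},\quad \mathbf{N}=\begin{bmatrix} D_2 & B_1^\top \\ B_2^\top & D_1 \end{bmatrix},\quad \mathbf{a}=\begin{bmatrix} a_1 \\ a_2 \end{bmatrix},\quad \mathbf{b}=\begin{bmatrix} b_2 \\ b_1 \end{bmatrix}.$$ Standing assumptions: $A_1,A_2\succ0$, and $M_1,M_2,\mathbf{M},\mathbf{N}$ are invertible. The Nash equilibrium is $\mathbf{u}_{\mathrm N}^\top=-\mathbf{a}^\top\mathbf{M}^{-1}$ and the altruistic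 Nash is $\mathbf{u}_{\mathrm A}^\top=-\mathbf{b}^\top\mathbf{N}^{-1}$. For social value orientations $\theta=(\theta_1,\theta_2)$ player $i$ uses the cost $\cos\theta_i\,J_i+\sin\theta_i\,J_{-i}$. The SVO-Nash equilibrium is the solution of the two first-order conditions (each in the player's own action), i.e. $\mathbf{u}_\theta^\top=-s_\theta^\top S_\theta^{-1}$, where $$s_\theta=\begin{bmatrix}\cos\theta_1a_1+\sin\theta_1b_2 \\ \cos\theta_2a_2+\sin\theta_2b_1\end{bmatrix},\quad S_\theta=\begin{bmatrix}\cos\theta_1A_1+\sin\theta_1D_2 & \cos\theta_2B_2+\sin\theta_2B_1^\top \\ \cos\theta_1B_1+\sin\theta_1B_2^\top & \cos\theta_2A_2+\sin\theta_2D_1\end{bmatrix}.$$ $X^{-\top}$ denotes $(X^{-1})^\top$. *)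

theory Defs
  imports "HOL-Analysis.Analysis"
begin

text \<open>The joint action space is indexed by the sum type \<^typ>\<open>'n + 'm\<close>, where
  \<^term>\<open>CARD('n)\<close> and \<^term>\<open>CARD('m)\<close> are the dimensions of the two action spaces.\<close>

definition join_vec :: "'a^'n \<Rightarrow> 'a^'m \<Rightarrow> 'a^('n::finite + 'm::finite)" where
  "join_vec x y = (\<chi> k. case k of Inl i \<Rightarrow> x $ i | Inr j \<Rightarrow> y $ j)"

definition fst_vec :: "'a^('n::finite + 'm::finite) \<Rightarrow> 'a^'n" where
  "fst_vec u = (\<chi> i. u $ Inl i)"

definition snd_vec :: "'a^('n::finite + 'm::finite) \<Rightarrow> 'a^'m" where
  "snd_vec u = (\<chi> j. u $ Inr j)"

definition block_mat ::
  "'a^'n^'r \<Rightarrow> 'a^'m^'r \<Rightarrow> 'a^'n^'s \<Rightarrow> 'a^'m^'s \<Rightarrow> 'a^('n::finite + 'm::finite)^('r::finite + 's::finite)" where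
  "block_mat P Q R T = join_vec (\<chi> i. join_vec (P $ i) (Q $ i)) (\<chi> i. join_vec (R $ i) (T $ i))"

definition pos_def :: "real^'n^'n \<Rightarrow> bool" where
  "pos_def A \<longleftrightarrow> transpose A = A \<and> (\<forall>x. x \<noteq> 0 \<longrightarrow> x \<bullet> (A *v x) > 0)"

definition quad_cost :: "real^'k^'k \<Rightarrow> real^'k \<Rightarrow> real^'k \<Rightarrow> real" where
  "quad_cost M c u = 1/2 * (u \<bullet> (M *v u)) + c \<bullet> u"

definition svo_cost :: "real \<Rightarrow> ('u \<Rightarrow> real) \<Rightarrow> ('u \<Rightarrow> real) \<Rightarrow> 'u \<Rightarrow> real" where
  "svo_cost \<theta> J_own J_other u = cos \<theta> * J_own u + sin \<theta> * J_other u"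

text \<open>The first-order conditions of the two players, each in the player's own action.\<close>

definition svo_nash ::
  "(real^('n::finite + 'm::finite) \<Rightarrow> real) \<Rightarrow> (real^('n::finite + 'm::finite) \<Rightarrow> real) \<Rightarrow> real \<Rightarrow> real \<Rightarrow> real^('n::finite + 'm::finite) \<Rightarrow> bool" where
  "svo_nash J1 J2 \<theta>1 \<theta>2 u \<longleftrightarrow>
     ((\<lambda>x. svo_cost \<theta>1 J1 J2 (join_vec x (snd_vec u))) has_derivative (\<lambda>h. 0)) (at (fst_vec u)) \<and>
     ((\<lambda>y. svo_cost \<theta>2 J2 J1 (join_vec (fst_vec u) y)) has_derivative (\<lambda>h. 0)) (at (snd_vec u))"

text \<open>The product \<open>w v\<^sup>T\<close>; there is no complex conjugation.\<close>

definition outer :: "'a::times^'r \<Rightarrow> 'a^'c \<Rightarrow> 'a^'c^'r" where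
  "outer w v = (\<chi> i j. w $ i * v $ j)"

lemma join_vec_nth [simp]: "join_vec x y $ Inl i = x $ i" "join_vec x y $ Inr j = y $ j"
  by (simp_all add: join_vec_def)

lemma join_vec_fst_snd [simp]: "join_vec (fst_vec u) (snd_vec u) = u"
  by (simp add: vec_eq_iff join_vec_def fst_vec_def snd_vec_def split: sum.split)

lemma fst_vec_join [simp]: "fst_vec (join_vec x y) = x"
  by (simp add: vec_eq_iff fst_vec_def)

lemma snd_vec_join [simp]: "snd_vec (join_vec x y) = y"
  by (simp add: vec_eq_iff snd_vec_def)

lemma join_vec_eq_iff: "u = v \<longleftrightarrow> fst_vec u = fst_vec v \<and> snd_vec u = snd_vec v"
  by (metis join_vec_fst_snd)

lemma fst_vec_linear [simp]:
  fixes u v :: "real^('n::finite + 'm::finite)"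
  shows "fst_vec (u + v) = fst_vec u + fst_vec v" "fst_vec (r *\<^sub>R u) = r *\<^sub>R fst_vec u"
    "fst_vec (- u) = - fst_vec u"
  by (simp_all add: vec_eq_iff fst_vec_def)

lemma snd_vec_linear [simp]:
  fixes u v :: "real^('n::finite + 'm::finite)"
  shows "snd_vec (u + v) = snd_vec u + snd_vec v" "snd_vec (r *\<^sub>R u) = r *\<^sub>R snd_vec u"
    "snd_vec (- u) = - snd_vec u"
  by (simp_all add: vec_eq_iff snd_vec_def)

lemma sum_UNIV_Plus:
  fixes f :: "'n::finite + 'm::finite \<Rightarrow> 'a::comm_monoid_add"
  shows "(\<Sum>k\<in>UNIV. f k) = (\<Sum>i\<in>UNIV. f (Inl i)) + (\<Sum>j\<in>UNIV. f (Inr j))"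
  by (simp add: UNIV_Plus_UNIV[symmetric] sum.Plus del: UNIV_Plus_UNIV)

lemma inner_join_vec:
  fixes x :: "real^'n" and y :: "real^'m"
  shows "u \<bullet> join_vec x y = fst_vec u \<bullet> x + snd_vec u \<bullet> y"
  by (simp add: inner_vec_def sum_UNIV_Plus fst_vec_def snd_vec_def)

lemma fst_vec_block_mat:
  fixes P :: "real^'n^'r" and Q :: "real^'m^'r" and R :: "real^'n^'s" and T :: "real^'m^'s"
  shows "fst_vec (block_mat P Q R T *v u) = P *v fst_vec u + Q *v snd_vec u"
  by (simp add: vec_eq_iff fst_vec_def snd_vec_def matrix_vector_mult_def block_mat_def sum_UNIV_Plus)

lemma snd_vec_block_mat:
  fixes P :: "real^'n^'r" and Q :: "real^'m^'r" and R :: "real^'n^'s" and T :: "real^'m^'s"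
  shows "snd_vec (block_mat P Q R T *v u) = R *v fst_vec u + T *v snd_vec u"
  by (simp add: vec_eq_iff fst_vec_def snd_vec_def matrix_vector_mult_def block_mat_def sum_UNIV_Plus)

lemma transpose_block_mat:
  "transpose (block_mat P Q R T) = block_mat (transpose P) (transpose R) (transpose Q) (transpose T)"
  by (simp add: vec_eq_iff transpose_def block_mat_def join_vec_def split: sum.split)

lemma block_mat_eq_iff:
  "block_mat P Q R T = block_mat P' Q' R' T' \<longleftrightarrow> P = P' \<and> Q = Q' \<and> R = R' \<and> T = T'"
proof
  assume eq: "block_mat P Q R T = block_mat P' Q' R' T'"
  have "P $ i $ j = P' $ i $ j" for i j
    using arg_cong[OF eq, of "\<lambda>X. X $ Inl i $ Inl j"] by (simp add: block_mat_def)
  moreover have "Q $ i $ j = Q' $ i $ j" for i j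
    using arg_cong[OF eq, of "\<lambda>X. X $ Inl i $ Inr j"] by (simp add: block_mat_def)
  moreover have "R $ i $ j = R' $ i $ j" for i j
    using arg_cong[OF eq, of "\<lambda>X. X $ Inr i $ Inl j"] by (simp add: block_mat_def)
  moreover have "T $ i $ j = T' $ i $ j" for i j
    using arg_cong[OF eq, of "\<lambda>X. X $ Inr i $ Inr j"] by (simp add: block_mat_def)
  ultimately show "P = P' \<and> Q = Q' \<and> R = R' \<and> T = T'"
    by (simp add: vec_eq_iff)
qed simp

lemma transpose_add: "transpose (A + B) = transpose A + transpose (B :: real^'n^'m)"
  by (simp add: vec_eq_iff transpose_def)

lemma transpose_scaleR: "transpose (r *\<^sub>R A) = r *\<^sub>R transpose (A :: real^'n^'m)"
  by (simp add: vec_eq_iff transpose_def)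

lemma has_derivative_quad_cost:
  fixes M :: "real^'k^'k"
  assumes "transpose M = M"
  shows "(quad_cost M c has_derivative (\<lambda>h. (M *v u + c) \<bullet> h)) (at u)"
proof -
  have lin: "((*v) M has_derivative (*v) M) (at u)"
    by (rule linear_imp_has_derivative) simp
  have sym: "u \<bullet> (M *v h) = (M *v u) \<bullet> h" for h
    by (metis assms dot_lmul_matrix vector_transpose_matrix)
  have "((\<lambda>u. 1/2 * (u \<bullet> (M *v u)) + c \<bullet> u) has_derivative
      (\<lambda>h. 1/2 * (u \<bullet> (M *v h) + h \<bullet> (M *v u)) + c \<bullet> h)) (at u)"
    by (intro has_derivative_add has_derivative_mult_right has_derivative_inner has_derivative_ident
        has_derivative_inner_right lin)
  moreover have "1/2 * (u \<bullet> (M *v h) + h \<bullet> (M *v u)) + c \<bullet> h = (M *v u + c) \<bullet> h" for h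
    unfolding sym by (simp add: inner_add_left inner_commute[of h])
  ultimately show ?thesis
    unfolding quad_cost_def by simp
qed

lemma has_derivative_svo_cost:
  assumes "transpose M1 = M1" "transpose M2 = M2"
  shows "(svo_cost \<theta> (quad_cost M1 c1) (quad_cost M2 c2) has_derivative
    (\<lambda>h. (cos \<theta> *\<^sub>R (M1 *v u + c1) + sin \<theta> *\<^sub>R (M2 *v u + c2)) \<bullet> h)) (at u)"
  unfolding svo_cost_def
  by (rule derivative_eq_intros has_derivative_quad_cost assms refl)+ (simp add: fun_eq_iff inner_add_left)

lemma linear_join_vec:
  "linear (\<lambda>h :: real^'n. join_vec h (0 :: real^'m))" "linear (\<lambda>h :: real^'m. join_vec (0 :: real^'n) h)"
  by (auto intro!: linearI simp: vec_eq_iff join_vec_def split: sum.split)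

lemma has_derivative_join_vec:
  fixes x :: "real^'n" and y :: "real^'m"
  shows "((\<lambda>x. join_vec x y) has_derivative (\<lambda>h. join_vec h 0)) (at x)"
    and "(join_vec x has_derivative (\<lambda>h. join_vec 0 h)) (at y)"
proof -
  have "(\<lambda>x::real^'n. join_vec x y) = (\<lambda>x. join_vec x 0 + join_vec 0 y)"
    "join_vec x = (\<lambda>y::real^'m. join_vec x 0 + join_vec 0 y)"
    by (auto simp: fun_eq_iff vec_eq_iff join_vec_def split: sum.split)
  note eq = this
  have "((\<lambda>x::real^'n. join_vec x 0 + join_vec 0 y) has_derivative (\<lambda>h. join_vec h 0 + 0)) (at x)"
    by (intro has_derivative_add has_derivative_const linear_imp_has_derivative linear_join_vec)
  then show "((\<lambda>x. join_vec x y) has_derivative (\<lambda>h. join_vec h 0)) (at x)"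
    by (subst eq(1)) simp
  have "((\<lambda>y::real^'m. join_vec x 0 + join_vec 0 y) has_derivative (\<lambda>h. 0 + join_vec 0 h)) (at y)"
    by (intro has_derivative_add has_derivative_const linear_imp_has_derivative linear_join_vec)
  then show "(join_vec x has_derivative (\<lambda>h. join_vec 0 h)) (at y)"
    by (subst eq(2)) simp
qed

lemma svo_nash_iff_gradient:
  fixes M1 M2 :: "real^('n::finite + 'm::finite)^('n::finite + 'm::finite)"
  assumes "transpose M1 = M1" "transpose M2 = M2"
  shows "svo_nash (quad_cost M1 c1) (quad_cost M2 c2) \<theta>1 \<theta>2 u \<longleftrightarrow>
    fst_vec (cos \<theta>1 *\<^sub>R (M1 *v u + c1) + sin \<theta>1 *\<^sub>R (M2 *v u + c2)) = 0 \<and>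
    snd_vec (cos \<theta>2 *\<^sub>R (M2 *v u + c2) + sin \<theta>2 *\<^sub>R (M1 *v u + c1)) = 0"
proof -
  define f where "f = svo_cost \<theta>1 (quad_cost M1 c1) (quad_cost M2 c2)"
  define g where "g = svo_cost \<theta>2 (quad_cost M2 c2) (quad_cost M1 c1)"
  define p where "p = cos \<theta>1 *\<^sub>R (M1 *v u + c1) + sin \<theta>1 *\<^sub>R (M2 *v u + c2)"
  define q where "q = cos \<theta>2 *\<^sub>R (M2 *v u + c2) + sin \<theta>2 *\<^sub>R (M1 *v u + c1)"
  have f: "((\<lambda>x. f (join_vec x (snd_vec u))) has_derivative (\<lambda>h. fst_vec p \<bullet> h)) (at (fst_vec u))"
    using has_derivative_compose[OF has_derivative_join_vec(1)[of "snd_vec u" "fst_vec u"],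
        of f "\<lambda>h. p \<bullet> h"] has_derivative_svo_cost[OF assms, of \<theta>1 c1 c2 u]
    by (simp add: f_def p_def inner_join_vec)
  have g: "((\<lambda>y. g (join_vec (fst_vec u) y)) has_derivative (\<lambda>h. snd_vec q \<bullet> h)) (at (snd_vec u))"
    using has_derivative_compose[OF has_derivative_join_vec(2)[of "fst_vec u" "snd_vec u"],
        of g "\<lambda>h. q \<bullet> h"] has_derivative_svo_cost[OF assms(2,1), of \<theta>2 c2 c1 u]
    by (simp add: g_def q_def inner_join_vec)
  have p: "(\<lambda>h. fst_vec p \<bullet> h) = (\<lambda>h. 0) \<longleftrightarrow> fst_vec p = 0"
    and q: "(\<lambda>h. snd_vec q \<bullet> h) = (\<lambda>h. 0) \<longleftrightarrow> snd_vec q = 0"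
    by (metis inner_eq_zero_iff inner_zero_left)+
  have "((\<lambda>x. f (join_vec x (snd_vec u))) has_derivative (\<lambda>h. 0)) (at (fst_vec u)) \<longleftrightarrow> fst_vec p = 0"
  proof
    assume "fst_vec p = 0"
    with f show "((\<lambda>x. f (join_vec x (snd_vec u))) has_derivative (\<lambda>h. 0)) (at (fst_vec u))" by simp
  next
    assume "((\<lambda>x. f (join_vec x (snd_vec u))) has_derivative (\<lambda>h. 0)) (at (fst_vec u))"
    from has_derivative_unique[OF f this] show "fst_vec p = 0" unfolding p .
  qed
  moreover have
    "((\<lambda>y. g (join_vec (fst_vec u) y)) has_derivative (\<lambda>h. 0)) (at (snd_vec u)) \<longleftrightarrow> snd_vec q = 0"
  proof
    assume "snd_vec q = 0"
    with g show "((\<lambda>y. g (join_vec (fst_vec u) y)) has_derivative (\<lambda>h. 0)) (at (snd_vec u))" by simp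
  next
    assume "((\<lambda>y. g (join_vec (fst_vec u) y)) has_derivative (\<lambda>h. 0)) (at (snd_vec u))"
    from has_derivative_unique[OF g this] show "snd_vec q = 0" unfolding q .
  qed
  ultimately show ?thesis
    unfolding svo_nash_def f_def[symmetric] g_def[symmetric] p_def[symmetric] q_def[symmetric]
    by simp
qed

lemma svo_nash_iff:
  fixes A1 D2 :: "real^'n^'n" and A2 D1 :: "real^'m^'m"
    and B1 :: "real^'n^'m" and B2 :: "real^'m^'n"
    and a1 b2 :: "real^'n" and a2 b1 :: "real^'m"
  assumes M1: "M1 = block_mat A1 (transpose B1) B1 D1" "transpose M1 = M1"
    and M2: "M2 = block_mat D2 B2 (transpose B2) A2" "transpose M2 = M2"
    and c1: "c1 = join_vec a1 b1" and c2: "c2 = join_vec b2 a2"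
    and s: "s = join_vec (cos \<theta>1 *\<^sub>R a1 + sin \<theta>1 *\<^sub>R b2) (cos \<theta>2 *\<^sub>R a2 + sin \<theta>2 *\<^sub>R b1)"
    and S: "S = block_mat (cos \<theta>1 *\<^sub>R A1 + sin \<theta>1 *\<^sub>R D2)
                          (cos \<theta>2 *\<^sub>R B2 + sin \<theta>2 *\<^sub>R transpose B1)
                          (cos \<theta>1 *\<^sub>R B1 + sin \<theta>1 *\<^sub>R transpose B2)
                          (cos \<theta>2 *\<^sub>R A2 + sin \<theta>2 *\<^sub>R D1)"
    and inv: "invertible S"
  shows "svo_nash (quad_cost M1 c1) (quad_cost M2 c2) \<theta>1 \<theta>2 u \<longleftrightarrow> u = - (s v* matrix_inv S)"
proof -
  have "block_mat (transpose A1) (transpose B1) (transpose (transpose B1)) (transpose D1)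
        = block_mat A1 (transpose B1) B1 D1"
    using M1(2) unfolding M1(1) transpose_block_mat .
  moreover have "block_mat (transpose D2) (transpose (transpose B2)) (transpose B2) (transpose A2)
        = block_mat D2 B2 (transpose B2) A2"
    using M2(2) unfolding M2(1) transpose_block_mat .
  ultimately have sym: "transpose A1 = A1" "transpose D1 = D1" "transpose A2 = A2" "transpose D2 = D2"
    unfolding block_mat_eq_iff by blast+
  have tS: "transpose S = block_mat (cos \<theta>1 *\<^sub>R A1 + sin \<theta>1 *\<^sub>R D2)
                          (cos \<theta>1 *\<^sub>R transpose B1 + sin \<theta>1 *\<^sub>R B2)
                          (cos \<theta>2 *\<^sub>R transpose B2 + sin \<theta>2 *\<^sub>R B1)
                          (cos \<theta>2 *\<^sub>R A2 + sin \<theta>2 *\<^sub>R D1)"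
    by (simp add: S transpose_block_mat transpose_add transpose_scaleR sym)
  have zero: "fst_vec (0 :: real^('n + 'm)) = 0" "snd_vec (0 :: real^('n + 'm)) = 0"
    by (simp_all add: vec_eq_iff fst_vec_def snd_vec_def)
  have "fst_vec (cos \<theta>1 *\<^sub>R (M1 *v u + c1) + sin \<theta>1 *\<^sub>R (M2 *v u + c2)) = fst_vec (transpose S *v u + s)"
    "snd_vec (cos \<theta>2 *\<^sub>R (M2 *v u + c2) + sin \<theta>2 *\<^sub>R (M1 *v u + c1)) = snd_vec (transpose S *v u + s)"
    unfolding tS unfolding M1(1) M2(1) c1 c2 s
    by (simp_all add: fst_vec_block_mat snd_vec_block_mat matrix_vector_mult_add_rdistrib
        scaleR_matrix_vector_assoc[symmetric] scaleR_add_right add_ac)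
  then have "svo_nash (quad_cost M1 c1) (quad_cost M2 c2) \<theta>1 \<theta>2 u \<longleftrightarrow> transpose S *v u + s = 0"
    unfolding svo_nash_iff_gradient[OF M1(2) M2(2)] join_vec_eq_iff[of "_ + s"] zero by simp
  also have "\<dots> \<longleftrightarrow> u v* S = - s"
    by (simp add: eq_neg_iff_add_eq_0)
  also have "\<dots> \<longleftrightarrow> u = (- s) v* matrix_inv S"
  proof -
    have "S ** matrix_inv S = mat 1" "matrix_inv S ** S = mat 1"
      using someI_ex[OF inv[unfolded invertible_def]] unfolding matrix_inv_def by auto
    then show ?thesis
      by (metis vector_matrix_mul_assoc vector_matrix_mul_rid)
  qed
  also have "(- s) v* matrix_inv S = - (s v* matrix_inv S)"
    by (simp add: vec_eq_iff vector_matrix_mult_def sum_negf)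
  finally show ?thesis .
qed

corollary nash_iff:
  assumes "M1 = block_mat A1 (transpose B1) B1 D1" "transpose M1 = M1"
    and "M2 = block_mat D2 B2 (transpose B2) A2" "transpose M2 = M2"
    and "c1 = join_vec a1 b1" and "c2 = join_vec b2 a2"
    and "M = block_mat A1 B2 B1 A2" and "a = join_vec a1 a2" and "invertible M"
  shows "svo_nash (quad_cost M1 c1) (quad_cost M2 c2) 0 0 u \<longleftrightarrow> u = - (a v* matrix_inv M)"
  by (rule svo_nash_iff[OF assms(1-6)]) (simp_all add: assms(7-9) assms(9)[unfolded assms(7)])

corollary altruistic_nash_iff:
  assumes "M1 = block_mat A1 (transpose B1) B1 D1" "transpose M1 = M1"
    and "M2 = block_mat D2 B2 (transpose B2) A2" "transpose M2 = M2"
    and "c1 = join_vec a1 b1" and "c2 = join_vec b2 a2"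
    and "N = block_mat D2 (transpose B1) (transpose B2) D1" and "b = join_vec b2 b1" and "invertible N"
  shows "svo_nash (quad_cost M1 c1) (quad_cost M2 c2) (pi/2) (pi/2) u \<longleftrightarrow> u = - (b v* matrix_inv N)"
  by (rule svo_nash_iff[OF assms(1-6)]) (simp_all add: assms(7-9) assms(9)[unfolded assms(7)])

end

theory Submission
  imports Defs
begin

text \<open>
  With \<open>cos \<theta>\<^sub>i\<close> factored out of the columns of block \<open>i\<close>, only the tangents \<open>t cos \<phi>\<close> and
  \<open>t sin \<phi>\<close> are left, so \<open>S\<^sub>\<theta> = (M + t N H) C\<close> and \<open>s\<^sub>\<theta>\<^sup>T = (a\<^sup>T + t b\<^sup>T H) C\<close>
  with \<open>C = blkdiag(cos \<theta>\<^sub>1 I, cos \<theta>\<^sub>2 I)\<close>. As \<open>C\<close> is invertible it cancels, and the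
  first-order conditions read \<open>u\<^sup>T (M + t N H) = - a\<^sup>T - t b\<^sup>T H\<close> (\<open>svo_system_factorization\<close>).

  Multiplying by \<open>H\<^sup>-\<^sup>1 N\<^sup>-\<^sup>1 / t\<close> turns the matrix on the left into the resolvent matrix
  \<open>L = K / t + I\<close> and the right-hand side into \<open>u\<^sub>N\<^sup>T K / t + u\<^sub>A\<^sup>T\<close>. Subtracting
  \<open>u\<^sub>N\<^sup>T L\<close> leaves \<open>(u - u\<^sub>N)\<^sup>T L = (u\<^sub>A - u\<^sub>N)\<^sup>T\<close>, which is the interpolation formula;
  \<open>L\<close> inherits invertibility from \<open>S\<^sub>\<theta>\<close> because it is \<open>S\<^sub>\<theta>\<close> times invertible factors
  (\<open>interpolation_between_row_equilibria\<close>).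

  The spectral form of \<open>G\<close> is the inverse of a diagonalizable matrix in a biorthogonal
  eigensystem (\<open>matrix_inv_biorthogonal\<close>): \<open>L\<close> has the eigenvectors of \<open>K\<close>, with eigenvalues
  \<open>\<lambda>\<^sub>i / t + 1\<close>, and invertibility of \<open>L\<close> is what keeps these from vanishing.
\<close>

section \<open>Inverses and matrices over the complex numbers\<close>

lemma matrix_inv_inverse:
  assumes "invertible A"
  shows "A ** matrix_inv A = mat 1" "matrix_inv A ** A = mat 1"
  using someI_ex[OF assms[unfolded invertible_def]] unfolding matrix_inv_def by auto

lemma matrix_inv_unique:
  fixes A :: "'a::semiring_1^'n^'n"
  assumes "A ** B = mat 1" "B ** A = mat 1"
  shows "matrix_inv A = B"
  by (metis assms invertible_def matrix_inv_inverse(2) matrix_mul_assoc matrix_mul_lid matrix_mul_rid)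

lemma invertible_matrix_inv: "invertible A \<Longrightarrow> invertible (matrix_inv A)"
  by (meson invertible_def matrix_inv_inverse)

lemma matrix_add_rdistrib:
  fixes A B :: "'a::semiring_1^'n^'m"
  shows "(A + B) ** C = A ** C + B ** C"
  by (simp add: vec_eq_iff matrix_matrix_mult_def sum.distrib distrib_right)

lemma map_matrix_of_real_mult:
  "map_matrix complex_of_real (A ** B) = map_matrix complex_of_real A ** map_matrix complex_of_real B"
  by (simp add: vec_eq_iff matrix_matrix_mult_def)

lemma map_matrix_of_real_mat_1: "map_matrix complex_of_real (mat 1) = mat 1"
  by (simp add: vec_eq_iff mat_def)

text \<open>
  The eigenvalues of a real matrix need not be real, so the spectral formula is an identity of
  complex matrices; this lemma carries the inverse of the real matrix over to it.
\<close>

lemma map_matrix_of_real_inverse: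
  fixes A :: "real^'n^'n"
  assumes "invertible A"
  shows "invertible (map_matrix complex_of_real A)"
    and "map_matrix complex_of_real (matrix_inv A) = matrix_inv (map_matrix complex_of_real A)"
proof -
  let ?c = "map_matrix complex_of_real"
  have "?c A ** ?c (matrix_inv A) = mat 1" "?c (matrix_inv A) ** ?c A = mat 1"
    by (simp_all add: matrix_inv_inverse[OF assms] map_matrix_of_real_mat_1
        flip: map_matrix_of_real_mult)
  then show "invertible (?c A)" "?c (matrix_inv A) = matrix_inv (?c A)"
    using matrix_inv_unique[of "?c A" "?c (matrix_inv A)"] by (auto simp: invertible_def)
qed

section \<open>Block-diagonal scalings\<close>

definition block_scaling :: "real \<Rightarrow> real \<Rightarrow> real^('n::finite + 'm::finite)^('n + 'm)" where
  "block_scaling \<alpha> \<beta> = block_mat (mat \<alpha>) 0 0 (mat \<beta>)"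

lemma block_scaling_nth:
  "block_scaling \<alpha> \<beta> $ k $ l = (if k = l then case k of Inl _ \<Rightarrow> \<alpha> | Inr _ \<Rightarrow> \<beta> else 0)"
  by (auto simp: block_scaling_def block_mat_def join_vec_def mat_def split: sum.split)

lemma matrix_mult_block_scaling:
  "(A ** block_scaling \<alpha> \<beta>) $ k $ l = A $ k $ l * (case l of Inl _ \<Rightarrow> \<alpha> | Inr _ \<Rightarrow> \<beta>)"
  by (simp add: matrix_matrix_mult_def block_scaling_nth if_distrib[of "\<lambda>x. _ * x"] cong: if_cong)

lemma vector_mult_block_scaling:
  "(x v* block_scaling \<alpha> \<beta>) $ l = (case l of Inl _ \<Rightarrow> \<alpha> | Inr _ \<Rightarrow> \<beta>) * x $ l"
  by (simp add: vector_matrix_mult_def block_scaling_nth if_distrib[of "\<lambda>c. _ * c"] mult.commute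
      cong: if_cong)

lemma invertible_block_scaling:
  assumes "\<alpha> \<noteq> 0" "\<beta> \<noteq> 0"
  shows "invertible (block_scaling \<alpha> \<beta> :: real^('n::finite + 'm::finite)^('n + 'm))"
proof -
  have "block_scaling x y ** block_scaling (1/x) (1/y) = (mat 1 :: real^('n + 'm)^('n + 'm))"
    if "x \<noteq> 0" "y \<noteq> 0" for x y
    using that
    by (auto simp: vec_eq_iff matrix_mult_block_scaling block_scaling_nth mat_def split: sum.split)
  from this[of \<alpha> \<beta>] this[of "1/\<alpha>" "1/\<beta>"] show ?thesis
    using assms unfolding invertible_def by (intro exI[of _ "block_scaling (1/\<alpha>) (1/\<beta>)"]) auto
qed

section \<open>Interpolation between the two equilibria\<close>

text \<open>
  The columns belonging to player \<open>i\<close> carry the common factor \<open>cos \<theta>\<^sub>i\<close>, which is where the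
  scaling on the right comes from; the remaining coefficient of the altruistic part is
  \<open>tan \<theta>\<^sub>i\<close>, and the pair of tangents is \<open>t\<close> times the block diagonal \<open>(p, q)\<close> of \<open>H\<close>.
\<close>

lemma svo_system_factorization:
  assumes "cos \<theta>1 \<noteq> 0" "cos \<theta>2 \<noteq> 0"
    and "tan \<theta>1 = t * p" "tan \<theta>2 = t * q"
  shows "block_mat (cos \<theta>1 *\<^sub>R A1 + sin \<theta>1 *\<^sub>R D2) (cos \<theta>2 *\<^sub>R B2 + sin \<theta>2 *\<^sub>R B1')
                   (cos \<theta>1 *\<^sub>R B1 + sin \<theta>1 *\<^sub>R B2') (cos \<theta>2 *\<^sub>R A2 + sin \<theta>2 *\<^sub>R D1)
       = (block_mat A1 B2 B1 A2 + t *\<^sub>R (block_mat D2 B1' B2' D1 ** block_scaling p q))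
           ** block_scaling (cos \<theta>1) (cos \<theta>2)" (is ?matrix)
    and "join_vec (cos \<theta>1 *\<^sub>R a1 + sin \<theta>1 *\<^sub>R b2) (cos \<theta>2 *\<^sub>R a2 + sin \<theta>2 *\<^sub>R b1)
       = (join_vec a1 a2 + t *\<^sub>R (join_vec b2 b1 v* block_scaling p q))
           v* block_scaling (cos \<theta>1) (cos \<theta>2)" (is ?vector)
proof -
  have sin: "sin \<theta>1 = t * p * cos \<theta>1" "sin \<theta>2 = t * q * cos \<theta>2"
    using assms by (simp_all add: tan_def field_simps)
  show ?matrix
    by (auto simp: vec_eq_iff matrix_mult_block_scaling block_mat_def join_vec_def sin algebra_simps
        split: sum.split)
  show ?vector
    by (auto simp: vec_eq_iff vector_mult_block_scaling join_vec_def sin algebra_simps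
        split: sum.split)
qed

text \<open>
  Multiplying the equation for \<open>u\<close> from the right by \<open>R = H\<^sup>-\<^sup>1 N\<^sup>-\<^sup>1 / t\<close> sends the
  altruistic data to \<open>t N H R = I\<close> and \<open>- t b\<^sup>T H R = u\<^sub>A\<^sup>T\<close>, and the selfish data to
  \<open>M R = K / t\<close> and \<open>- a\<^sup>T R = u\<^sub>N\<^sup>T K / t\<close>. The equation becomes
  \<open>u\<^sup>T L = u\<^sub>N\<^sup>T K / t + u\<^sub>A\<^sup>T\<close>, whose right-hand side differs from \<open>u\<^sub>N\<^sup>T L\<close> by
  \<open>u\<^sub>A\<^sup>T - u\<^sub>N\<^sup>T\<close>. The transpose in the conclusion appears because \<open>L\<close> acts on row vectors.
\<close>

lemma interpolation_between_row_equilibria: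
  fixes M N H :: "real^'k^'k" and a b u :: "real^'k" and t :: real
  defines "K \<equiv> M ** matrix_inv H ** matrix_inv N"
  defines "L \<equiv> (1/t) *\<^sub>R K + mat 1"
  assumes inv: "invertible M" "invertible N" "invertible H" "invertible (M + t *\<^sub>R (N ** H))"
    and t: "t \<noteq> 0"
    and u: "u v* (M + t *\<^sub>R (N ** H)) = - (a + t *\<^sub>R (b v* H))"
  defines "uN \<equiv> - (a v* matrix_inv M)" and "uA \<equiv> - (b v* matrix_inv N)"
  shows "invertible L" and "u = uN + transpose (matrix_inv L) *v (uA - uN)"
proof -
  define R where "R = (1/t) *\<^sub>R (matrix_inv H ** matrix_inv N)"
  have NHR: "t *\<^sub>R (N ** H) ** R = mat 1"
    using t unfolding R_def
    by (simp add: matrix_scalar_ac scalar_matrix_assoc[symmetric])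
       (metis inv(2,3) matrix_inv_inverse(1) matrix_mul_assoc matrix_mul_rid)
  have HR: "t *\<^sub>R (x v* H) v* R = x v* matrix_inv N" for x
    using t unfolding R_def
    by (simp add: vector_scaleR_matrix_ac scaleR_vector_matrix_assoc vector_matrix_mul_assoc)
       (metis inv(3) matrix_inv_inverse(1) matrix_mul_assoc matrix_mul_lid)
  have MR: "M ** R = (1/t) *\<^sub>R K"
    by (simp add: R_def K_def matrix_scalar_ac scalar_matrix_assoc matrix_mul_assoc)
  have L: "L = (M + t *\<^sub>R (N ** H)) ** R"
    unfolding L_def matrix_add_rdistrib NHR MR ..
  have "invertible R"
    unfolding R_def using t inv
    by (intro scalar_invertible invertible_mult invertible_matrix_inv) auto
  then show invL: "invertible L"
    unfolding L using inv(4) by (rule invertible_mult[rotated])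
  have neg: "(- x) v* A = - (x v* A)" for x :: "real^'k" and A :: "real^'k^'k"
    using scaleR_vector_matrix_assoc[of "-1" x A] by simp
  have aR: "uN v* ((1/t) *\<^sub>R K) = - (a v* R)"
    unfolding uN_def MR[symmetric] neg
    by (simp add: vector_matrix_mul_assoc matrix_mul_assoc matrix_inv_inverse inv)
  have "u v* L = - (a v* R) - b v* matrix_inv N"
    unfolding L vector_matrix_mul_assoc[symmetric] u neg vector_matrix_left_distrib HR by simp
  also have "\<dots> = uN v* L + (uA - uN)"
    unfolding L_def vector_matrix_mult_add_rdistrib aR by (simp add: uA_def)
  finally have "(u - uN) v* L = uA - uN"
    by (simp add: vector_matrix_mult_diff_distrib)
  then have "u - uN = (uA - uN) v* matrix_inv L"
    by (metis invL matrix_inv_inverse(1) vector_matrix_mul_assoc vector_matrix_mul_rid)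
  then show "u = uN + transpose (matrix_inv L) *v (uA - uN)"
    by (simp add: algebra_simps)
qed

section \<open>Inverting a matrix in a biorthogonal eigensystem\<close>

lemma outer_mult_vector:
  fixes x v w :: "'a::comm_semiring_1^'k"
  shows "outer v w *v x = (\<Sum>k\<in>UNIV. w $ k * x $ k) *s v"
  by (simp add: vec_eq_iff outer_def matrix_vector_mult_def sum_distrib_left mult_ac)

lemma sum_matrix_mult_vector: "(\<Sum>i\<in>I. A i) *v x = (\<Sum>i\<in>I. A i *v x)"
  by (induction I rule: infinite_finite_induct) (auto simp: matrix_vector_mult_add_rdistrib)

text \<open>
  The eigenvectors span the space, so it is enough that \<open>L\<close> followed by the sum fixes each \<open>V j\<close>: \<open>L\<close> multiplies it by \<open>\<mu> j\<close>, and by duality the sum divides it by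
  \<open>\<mu> j\<close> again. An eigenvalue \<open>0\<close> would put \<open>V j\<close>, which duality
  makes nonzero, into the kernel of \<open>L\<close>.
\<close>

lemma matrix_inv_biorthogonal:
  fixes L :: "'a::field^'k^'k"
  assumes "invertible L" and "finite I"
    and eigen: "\<And>i. i \<in> I \<Longrightarrow> L *v V i = \<mu> i *s V i"
    and span: "vec.span (V ` I) = UNIV"
    and dual: "\<And>i j. i \<in> I \<Longrightarrow> j \<in> I \<Longrightarrow>
                 (\<Sum>k\<in>UNIV. W i $ k * V j $ k) = (if i = j then 1 else 0)"
  shows "\<And>i. i \<in> I \<Longrightarrow> \<mu> i \<noteq> 0"
    and "matrix_inv L = (\<Sum>i\<in>I. outer ((1 / \<mu> i) *s V i) (W i))"
proof -
  show nz: "\<mu> i \<noteq> 0" if "i \<in> I" for i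
  proof
    assume "\<mu> i = 0"
    then have "L *v V i = 0" using eigen[OF that] by simp
    then have "V i = 0"
      by (metis assms(1) matrix_inv_inverse(2) matrix_vector_mul_assoc matrix_vector_mul_lid
          matrix_vector_mult_0_right)
    then show False using dual[OF that that] by simp
  qed
  define Y where "Y = (\<Sum>i\<in>I. outer ((1 / \<mu> i) *s V i) (W i))"
  have Y: "Y *v (L *v V j) = V j" if j: "j \<in> I" for j
  proof -
    have "Y *v V j = (\<Sum>i\<in>I. if i = j then (1 / \<mu> j) *s V j else 0)"
      unfolding Y_def sum_matrix_mult_vector outer_mult_vector using dual j by (intro sum.cong) auto
    also have "\<dots> = (1 / \<mu> j) *s V j"
      using j \<open>finite I\<close> by simp
    finally show ?thesis
      using nz[OF j] by (simp add: eigen[OF j] vec.scale)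
  qed
  have "(Y ** L) *v x = x" for x
  proof -
    have "x \<in> vec.span (V ` I)" by (simp add: span)
    then show ?thesis
      by (induction rule: vec.span_induct_alt)
         (auto simp: matrix_vector_right_distrib vec.scale Y simp flip: matrix_vector_mul_assoc)
  qed
  then have "Y ** L = mat 1" by (simp add: matrix_eq)
  then show "matrix_inv L = (\<Sum>i\<in>I. outer ((1 / \<mu> i) *s V i) (W i))"
    unfolding Y_def[symmetric] using matrix_inv_unique matrix_left_right_inverse by metis
qed

section \<open>The SVO-Nash equilibrium\<close>

theorem proposition2:
  fixes A1 D2 :: "real^'n^'n" and A2 D1 :: "real^'m^'m"
    and B1 :: "real^'n^'m" and B2 :: "real^'m^'n"
    and a1 b2 :: "real^'n" and a2 b1 :: "real^'m"
    and M1 M2 M N S H K G :: "real^('n + 'm)^('n + 'm)"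
    and c1 c2 a b uN uA u :: "real^('n + 'm)"
    and \<theta>1 \<theta>2 \<phi> t :: real
    and d :: nat
    and lam :: "nat \<Rightarrow> complex"
    and V W :: "nat \<Rightarrow> complex^('n + 'm)"
  assumes M1: "M1 = block_mat A1 (transpose B1) B1 D1" "transpose M1 = M1"
    and M2: "M2 = block_mat D2 B2 (transpose B2) A2" "transpose M2 = M2"
    and c1: "c1 = join_vec a1 b1" and c2: "c2 = join_vec b2 a2"
    and M: "M = block_mat A1 B2 B1 A2"
    and N: "N = block_mat D2 (transpose B1) (transpose B2) D1"
    and a: "a = join_vec a1 a2" and b: "b = join_vec b2 b1"
    and pos: "pos_def A1" "pos_def A2"
    and inv: "invertible M1" "invertible M2" "invertible M" "invertible N"
    and uN: "uN = - (a v* matrix_inv M)"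
    and uA: "uA = - (b v* matrix_inv N)"
    and \<theta>: "0 < \<theta>1" "\<theta>1 < pi/2" "0 < \<theta>2" "\<theta>2 < pi/2"
    and S: "S = block_mat (cos \<theta>1 *\<^sub>R A1 + sin \<theta>1 *\<^sub>R D2)
                          (cos \<theta>2 *\<^sub>R B2 + sin \<theta>2 *\<^sub>R transpose B1)
                          (cos \<theta>1 *\<^sub>R B1 + sin \<theta>1 *\<^sub>R transpose B2)
                          (cos \<theta>2 *\<^sub>R A2 + sin \<theta>2 *\<^sub>R D1)"
    and inv_S: "invertible S"
    and u: "svo_nash (quad_cost M1 c1) (quad_cost M2 c2) \<theta>1 \<theta>2 u"
    and \<phi>: "0 < \<phi>" "\<phi> < pi/2" and t: "0 < t"
    and \<Theta>: "tan \<theta>1 = t * cos \<phi>" "tan \<theta>2 = t * sin \<phi>"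
    and H: "H = block_mat (mat (cos \<phi>)) 0 0 (mat (sin \<phi>))"
    and K: "K = M ** matrix_inv H ** matrix_inv N"
    and d: "d = CARD('n) + CARD('m)"
    and right: "\<And>i. i \<in> {1..d} \<Longrightarrow> map_matrix complex_of_real K *v V i = lam i *s V i"
    and basis: "inj_on V {1..d}" "vec.independent (V ` {1..d})" "vec.span (V ` {1..d}) = UNIV"
    and left: "\<And>i. i \<in> {1..d} \<Longrightarrow> W i v* map_matrix complex_of_real K = lam i *s W i"
    and dual: "\<And>i j. i \<in> {1..d} \<Longrightarrow> j \<in> {1..d} \<Longrightarrow>
                 (\<Sum>k\<in>UNIV. W i $ k * V j $ k) = (if i = j then 1 else 0)"
    and G: "G = transpose (matrix_inv ((1/t) *\<^sub>R K + mat 1))"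
  shows "invertible ((1/t) *\<^sub>R K + mat 1) \<and> (\<forall>i\<in>{1..d}. lam i + of_real t \<noteq> 0) \<and>
         u = uN + G *v (uA - uN) \<and>
         map_matrix complex_of_real G =
           (\<Sum>i=1..d. outer (W i) ((of_real t / (lam i + of_real t)) *s V i))"
proof -
  let ?c = "map_matrix complex_of_real" and ?L = "(1/t) *\<^sub>R K + mat 1"
  define C :: "real^('n + 'm)^('n + 'm)" where "C = block_scaling (cos \<theta>1) (cos \<theta>2)"
  define s where "s = join_vec (cos \<theta>1 *\<^sub>R a1 + sin \<theta>1 *\<^sub>R b2) (cos \<theta>2 *\<^sub>R a2 + sin \<theta>2 *\<^sub>R b1)"
  have cos: "cos \<theta>1 \<noteq> 0" "cos \<theta>2 \<noteq> 0" and "cos \<phi> \<noteq> 0" "sin \<phi> \<noteq> 0"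
    using \<theta> \<phi> cos_gt_zero[of \<theta>1] cos_gt_zero[of \<theta>2] cos_gt_zero[of \<phi>] sin_gt_zero[of \<phi>] by auto
  have H': "H = block_scaling (cos \<phi>) (sin \<phi>)"
    by (simp add: H block_scaling_def)
  have invH: "invertible H" and invC: "invertible C"
    unfolding H' C_def by (intro invertible_block_scaling; fact)+
  have S_factor: "S = (M + t *\<^sub>R (N ** H)) ** C"
    and s_factor: "s = (a + t *\<^sub>R (b v* H)) v* C"
    unfolding S s_def M N a b H' C_def
    using svo_system_factorization[OF cos \<Theta>] by blast+
  have C_cancel: "x v* C v* matrix_inv C = x" for x
    by (simp add: vector_matrix_mul_assoc matrix_inv_inverse[OF invC])
  have "M + t *\<^sub>R (N ** H) = S ** matrix_inv C"
    by (simp add: S_factor matrix_inv_inverse[OF invC] flip: matrix_mul_assoc)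
  then have inv_MNH: "invertible (M + t *\<^sub>R (N ** H))"
    using inv_S invC by (simp add: invertible_mult invertible_matrix_inv)
  have "u = - (s v* matrix_inv S)"
    using u unfolding svo_nash_iff[OF M1 M2 c1 c2 s_def S inv_S] .
  then have "u v* S = - s"
    using scaleR_vector_matrix_assoc[of "-1" "s v* matrix_inv S" S]
    by (simp add: vector_matrix_mul_assoc matrix_inv_inverse[OF inv_S])
  then have "u v* (M + t *\<^sub>R (N ** H)) v* C = (- (a + t *\<^sub>R (b v* H))) v* C"
    using scaleR_vector_matrix_assoc[of "-1" "a + t *\<^sub>R (b v* H)" C]
    by (simp add: S_factor s_factor vector_matrix_mul_assoc)
  then have foc: "u v* (M + t *\<^sub>R (N ** H)) = - (a + t *\<^sub>R (b v* H))"
    by (metis C_cancel)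
  have "t \<noteq> 0" using t by simp
  note interpolation = interpolation_between_row_equilibria[OF inv(3,4) invH inv_MNH \<open>t \<noteq> 0\<close> foc]
  have invL: "invertible ?L"
    using interpolation(1) unfolding K .
  have u_eq: "u = uN + G *v (uA - uN)"
    using interpolation(2) unfolding G K uN uA .

  define \<mu> where "\<mu> i = lam i / of_real t + 1" for i
  have eigen: "?c ?L *v V i = \<mu> i *s V i" if "i \<in> {1..d}" for i
  proof -
    have "?c ?L *v x = (1 / of_real t) *s (?c K *v x) + x" for x
    proof -
      have "?c ?L = (\<chi> k l. ?c K $ k $ l / of_real t) + mat 1"
        by (simp add: vec_eq_iff mat_def)
      then show ?thesis
        by (simp add: matrix_vector_mult_add_rdistrib)
           (simp add: vec_eq_iff matrix_vector_mult_def sum_divide_distrib)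
    qed
    then show ?thesis
      by (simp add: right[OF that] \<mu>_def vec_eq_iff algebra_simps)
  qed
  note spectral = matrix_inv_biorthogonal[where I = "{1..d}" and V = V and W = W and \<mu> = \<mu>,
      OF map_matrix_of_real_inverse(1)[OF invL] finite_atLeastAtMost eigen basis(3) dual]
  \<comment> \<open>An eigenvalue \<open>\<lambda>\<close> of \<open>K\<close> becomes \<open>\<lambda> / t + 1\<close> for the resolvent matrix, whence the weights.\<close>
  have weight: "1 / \<mu> i = of_real t / (lam i + of_real t)" for i
    using t by (simp add: \<mu>_def divide_simps)
  have "lam i + of_real t \<noteq> 0" if "i \<in> {1..d}" for i
    using spectral(1)[of i] that t by (simp add: \<mu>_def divide_simps)
  moreover have "?c G = (\<Sum>i=1..d. outer (W i) ((of_real t / (lam i + of_real t)) *s V i))"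
  proof -
    have "?c G = transpose (?c (matrix_inv ?L))"
      by (simp add: G vec_eq_iff transpose_def)
    also have "\<dots> = transpose (\<Sum>i=1..d. outer ((1 / \<mu> i) *s V i) (W i))"
      using spectral(2) by (simp only: map_matrix_of_real_inverse(2)[OF invL])
    also have "\<dots> = (\<Sum>i=1..d. outer (W i) ((1 / \<mu> i) *s V i))"
      by (simp add: vec_eq_iff transpose_def outer_def mult_ac)
    finally show ?thesis unfolding weight .
  qed
  ultimately show ?thesis
    using invL u_eq by blast
qed

end
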